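(* Let $G$ be an ordered group and let $S$ be a finite subset of $G$. Then: (i) $|S^2|\ge 2|S|-1$; (ii) if $2|S|-1\le |S^2|\le 3|S|-4$, then $\langle S\rangle$ is abelian and generated by at most $2$ elements; (iii) if $|S^2|=3|S|-3$, then $\langle S\rangle$ is abelian and generated by at most $3$ elements; (iv) if $|S^2|=3|S|-3+b$ for some integer $b\ge 1$, then either $|S|=4$, $b=1$, and $\langle S\rangle$ is abelian and generated by at most $b+3$ elements, or $\langle S\rangle$ is generated by at most $b+2$ elements.
   Context: An ordered group is a group $G$ with a total order $\le$ such that $a\le b$ implies $xay\le xby$ for all $a,b,x,y\in G$. For a subset $S$, $S^2=\{x_1x_2 : x_1,x_2\in S\}$, and $\langle S\rangle$ is the subgroup generated by $S$. *)

theory Defs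
  imports "HOL-Algebra.Algebra"
begin

locale ordered_group = group G for G (structure) +
  fixes r :: "'a rel"
  assumes linear_order: "linear_order_on (carrier G) r"
    and mult_mono:
      "\<lbrakk>a \<in> carrier G; b \<in> carrier G; x \<in> carrier G; y \<in> carrier G; (a, b) \<in> r\<rbrakk>
        \<Longrightarrow> (x \<otimes> a \<otimes> y, x \<otimes> b \<otimes> y) \<in> r"

definition generated_by_at_most :: "('a, 'b) monoid_scheme \<Rightarrow> 'a set \<Rightarrow> nat \<Rightarrow> bool"
  where "generated_by_at_most G H n \<longleftrightarrow>
    (\<exists>T. T \<subseteq> H \<and> finite T \<and> card T \<le> n \<and> generate G T = H)"

end

theory Submission
  imports Defs
begin

text \<open>
  Write \<open>S = T \<union> {c}\<close> with \<open>c = max S\<close>, and call the elements of \<open>S\<^sup>2 - T\<^sup>2\<close> new. If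
  \<open>m \<in> S\<close> and \<open>max (c m, m c) = u v\<close> with \<open>u, v \<in> T\<close>, then \<open>u, v < c\<close> forces \<open>u, v > m\<close>; so this
  product is new unless \<open>m\<close> lies in the subgroup generated by the elements of \<open>S\<close> above it. The
  map \<open>m \<mapsto> max (c m, m c)\<close> is strictly increasing and the exceptional \<open>m\<close> are redundant as
  generators, hence \<open>\<langle>S\<rangle>\<close> is generated by at most as many elements as there are new products, and
  it is abelian if there are only two. If \<open>c \<notin> \<langle>T\<rangle>\<close>, then \<open>c T \<union> T c \<union> {c\<^sup>2}\<close> is new and has at
  least \<open>|S|\<close> elements, even \<open>|S| + 1\<close> unless \<open>c\<close> centralizes \<open>T\<close>. Everything follows by
  induction on \<open>|S|\<close>, removing the maximum.
\<close>

section \<open>Generating sets\<close>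

definition pairwise_commuting :: "('a, 'b) monoid_scheme \<Rightarrow> 'a set \<Rightarrow> bool" where
  "pairwise_commuting G A \<longleftrightarrow> (\<forall>x\<in>A. \<forall>y\<in>A. x \<otimes>\<^bsub>G\<^esub> y = y \<otimes>\<^bsub>G\<^esub> x)"

context group
begin

section \<open>Centralizers and commuting generators\<close>

lemma subgroup_centralizer:
  assumes "A \<subseteq> carrier G"
  shows "subgroup {x \<in> carrier G. \<forall>y\<in>A. x \<otimes> y = y \<otimes> x} G"
proof (rule subgroupI)
  fix x assume x: "x \<in> {x \<in> carrier G. \<forall>y\<in>A. x \<otimes> y = y \<otimes> x}"
  have "inv x \<otimes> y = y \<otimes> inv x" if "y \<in> A" for y
  proof -
    have y: "y \<in> carrier G" and eq: "x \<otimes> y = y \<otimes> x" using that x assms by auto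
    have "inv x \<otimes> y = inv x \<otimes> (y \<otimes> x) \<otimes> inv x"
      using x y by (simp add: m_assoc)
    also have "\<dots> = inv x \<otimes> (x \<otimes> y) \<otimes> inv x" by (simp add: eq)
    also have "\<dots> = y \<otimes> inv x"
      using x y by (simp add: m_assoc[symmetric])
    finally show ?thesis .
  qed
  then show "inv x \<in> {x \<in> carrier G. \<forall>y\<in>A. x \<otimes> y = y \<otimes> x}" using x by simp
next
  fix x z assume "x \<in> {x \<in> carrier G. \<forall>y\<in>A. x \<otimes> y = y \<otimes> x}"
    and "z \<in> {x \<in> carrier G. \<forall>y\<in>A. x \<otimes> y = y \<otimes> x}"
  then show "x \<otimes> z \<in> {x \<in> carrier G. \<forall>y\<in>A. x \<otimes> y = y \<otimes> x}"
    using assms by (auto simp: subset_iff) (metis m_assoc)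
next
  have "\<one> \<in> {x \<in> carrier G. \<forall>y\<in>A. x \<otimes> y = y \<otimes> x}" using assms by auto
  then show "{x \<in> carrier G. \<forall>y\<in>A. x \<otimes> y = y \<otimes> x} \<noteq> {}" by blast
qed auto

text \<open>The centralizer of \<open>A\<close> is a subgroup containing \<open>A\<close>, hence it
  contains \<open>generate G A\<close>. Read the other way, \<open>A\<close> centralizes
  \<open>generate G A\<close>, and the same argument applied once more finishes.\<close>

lemma commuting_generate:
  assumes A: "A \<subseteq> carrier G" and "pairwise_commuting G A"
  shows "pairwise_commuting G (generate G A)"
proof -
  have "generate G A \<subseteq> {x \<in> carrier G. \<forall>y\<in>A. x \<otimes> y = y \<otimes> x}"
    using assms by (intro generate_subgroup_incl subgroup_centralizer) (auto simp: pairwise_commuting_def)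
  then have "A \<subseteq> {x \<in> carrier G. \<forall>y\<in>generate G A. x \<otimes> y = y \<otimes> x}"
    using A by (auto simp: subset_iff)
  then have "generate G A \<subseteq> {x \<in> carrier G. \<forall>y\<in>generate G A. x \<otimes> y = y \<otimes> x}"
    using subgroup_centralizer[OF generate_incl[OF A]] by (rule generate_subgroup_incl)
  then show ?thesis by (auto simp: pairwise_commuting_def)
qed

lemma comm_group_generate:
  assumes "A \<subseteq> carrier G" and "pairwise_commuting G A"
  shows "comm_group (G\<lparr>carrier := generate G A\<rparr>)"
proof (rule group.group_comm_groupI)
  show "group (G\<lparr>carrier := generate G A\<rparr>)"
    using assms(1) by (intro subgroup_imp_group generate_is_subgroup)
qed (use commuting_generate[OF assms] in \<open>auto simp: pairwise_commuting_def\<close>)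

lemma commuting_subset: "pairwise_commuting G B \<Longrightarrow> A \<subseteq> B \<Longrightarrow> pairwise_commuting G A"
  by (auto simp: pairwise_commuting_def)

section \<open>Bounding the number of generators\<close>

lemma generate_insert_absorb:
  assumes "A \<subseteq> carrier G" and "c \<in> generate G A"
  shows "generate G (insert c A) = generate G A"
proof
  have "insert c A \<subseteq> generate G A" using assms by (auto intro: generate.incl)
  then show "generate G (insert c A) \<subseteq> generate G A"
    using assms(1) by (intro generate_subgroup_incl generate_is_subgroup)
qed (intro mono_generate, auto)

lemma generated_by_at_most_mono:
  assumes "generated_by_at_most G H m" and "m \<le> n"
  shows "generated_by_at_most G H n"
proof -
  obtain A where "A \<subseteq> H" "finite A" "card A \<le> m" "generate G A = H"
    using assms(1) by (auto simp: generated_by_at_most_def)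
  then show ?thesis
    using assms(2) unfolding generated_by_at_most_def by (intro exI[of _ A]) simp
qed

lemma generated_by_at_most_card:
  assumes "A \<subseteq> B" and "generate G A = generate G B" and "finite A" and "card A \<le> n"
  shows "generated_by_at_most G (generate G B) n"
  unfolding generated_by_at_most_def
  using assms by (intro exI[of _ A]) (auto intro: generate.incl)

text \<open>The bound for \<open>A\<close> is witnessed by a set \<open>B\<close> of arbitrary
  elements of \<open>generate G A\<close>, so it is \<open>B\<close>, rather than a subset of
  \<open>A\<close>, that is enlarged by \<open>c\<close>.\<close>

lemma generated_by_at_most_insert:
  assumes A: "A \<subseteq> carrier G" and c: "c \<in> carrier G"
    and "generated_by_at_most G (generate G A) n"
  shows "generated_by_at_most G (generate G (insert c A)) (Suc n)"
proof -
  obtain B where B: "B \<subseteq> generate G A" "finite B" "card B \<le> n" "generate G B = generate G A"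
    using assms(3) by (auto simp: generated_by_at_most_def)
  have Bc: "B \<subseteq> carrier G" using B(1) generate_incl[OF A] by blast
  have sub: "insert c B \<subseteq> generate G (insert c A)"
    using B(1) mono_generate[of A "insert c A"] by (auto intro: generate.incl)
  have "A \<subseteq> generate G (insert c B)"
    using B(4) mono_generate[of B "insert c B"] by (auto intro: generate.incl)
  then have "insert c A \<subseteq> generate G (insert c B)" by (auto intro: generate.incl)
  then have "generate G (insert c A) \<subseteq> generate G (insert c B)"
    using Bc c by (intro generate_subgroup_incl generate_is_subgroup) auto
  moreover have "generate G (insert c B) \<subseteq> generate G (insert c A)"
    using sub A c by (intro generate_subgroup_incl generate_is_subgroup) auto
  moreover have "card (insert c B) \<le> Suc n" using B(2,3) card_insert_le_m1[of "Suc n" B c] by simp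
  ultimately show ?thesis
    unfolding generated_by_at_most_def using sub B(2) by (intro exI[of _ "insert c B"]) auto
qed

end

lemma finite_set_mult: "finite A \<Longrightarrow> finite B \<Longrightarrow> finite (A <#>\<^bsub>G\<^esub> B)"
  by (auto simp: set_mult_def)

lemma set_multI: "a \<in> A \<Longrightarrow> b \<in> B \<Longrightarrow> a \<otimes>\<^bsub>G\<^esub> b \<in> A <#>\<^bsub>G\<^esub> B"
  by (auto simp: set_mult_def)

section \<open>Ordered groups\<close>

context ordered_group
begin

definition less :: "'a \<Rightarrow> 'a \<Rightarrow> bool" (infix "\<prec>\<^sub>r" 50) where
  "a \<prec>\<^sub>r b \<longleftrightarrow> (a, b) \<in> r \<and> a \<noteq> b"

lemma less_irrefl: "\<not> a \<prec>\<^sub>r a"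
  by (simp add: less_def)

lemma less_asym: "a \<prec>\<^sub>r b \<Longrightarrow> \<not> b \<prec>\<^sub>r a"
  using linear_order
  by (auto simp: less_def linear_order_on_def partial_order_on_def antisym_def)

lemma less_trans: "a \<prec>\<^sub>r b \<Longrightarrow> b \<prec>\<^sub>r c \<Longrightarrow> a \<prec>\<^sub>r c"
  using linear_order
  unfolding less_def linear_order_on_def partial_order_on_def preorder_on_def antisym_def trans_def
  by metis

lemma less_linear: "a \<in> carrier G \<Longrightarrow> b \<in> carrier G \<Longrightarrow> a \<prec>\<^sub>r b \<or> a = b \<or> b \<prec>\<^sub>r a"
  using linear_order by (auto simp: less_def linear_order_on_def total_on_def)

lemma mult_less_left:
  assumes "a \<prec>\<^sub>r b" "a \<in> carrier G" "b \<in> carrier G" "x \<in> carrier G"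
  shows "x \<otimes> a \<prec>\<^sub>r x \<otimes> b"
  using assms mult_mono[of a b x \<one>] by (auto simp: less_def)

lemma mult_less_right:
  assumes "a \<prec>\<^sub>r b" "a \<in> carrier G" "b \<in> carrier G" "x \<in> carrier G"
  shows "a \<otimes> x \<prec>\<^sub>r b \<otimes> x"
  using assms mult_mono[of a b \<one> x] by (auto simp: less_def)

lemma mult_less_left_cancel:
  "x \<otimes> a \<prec>\<^sub>r x \<otimes> b \<Longrightarrow> a \<in> carrier G \<Longrightarrow> b \<in> carrier G \<Longrightarrow> x \<in> carrier G \<Longrightarrow> a \<prec>\<^sub>r b"
  using less_linear[of a b] mult_less_left[of b a x] less_asym less_irrefl by blast

lemma mult_less_right_cancel:
  "a \<otimes> x \<prec>\<^sub>r b \<otimes> x \<Longrightarrow> a \<in> carrier G \<Longrightarrow> b \<in> carrier G \<Longrightarrow> x \<in> carrier G \<Longrightarrow> a \<prec>\<^sub>r b"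
  using less_linear[of a b] mult_less_right[of b a x] less_asym less_irrefl by blast

section \<open>Extremal elements and induction by removing the maximum\<close>

lemma finite_has_greatest:
  assumes "finite A" "A \<noteq> {}" "A \<subseteq> carrier G"
  shows "\<exists>m\<in>A. \<forall>x\<in>A - {m}. x \<prec>\<^sub>r m"
  using assms
proof (induction rule: finite_ne_induct)
  case (insert x F)
  then obtain m where m: "m \<in> F" "\<forall>y\<in>F - {m}. y \<prec>\<^sub>r m" by auto
  then consider "x \<prec>\<^sub>r m" | "m \<prec>\<^sub>r x"
    using insert.hyps insert.prems less_linear[of x m] by auto
  then show ?case
  proof cases
    case 1
    then show ?thesis using m by (intro bexI[of _ m]) auto
  next
    case 2
    then show ?thesis using m less_trans by (intro bexI[of _ x]) auto
  qed
qed auto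

lemma finite_has_least:
  assumes "finite A" "A \<noteq> {}" "A \<subseteq> carrier G"
  shows "\<exists>m\<in>A. \<forall>x\<in>A - {m}. m \<prec>\<^sub>r x"
  using assms
proof (induction rule: finite_ne_induct)
  case (insert x F)
  then obtain m where m: "m \<in> F" "\<forall>y\<in>F - {m}. m \<prec>\<^sub>r y" by auto
  then consider "x \<prec>\<^sub>r m" | "m \<prec>\<^sub>r x"
    using insert.hyps insert.prems less_linear[of x m] by auto
  then show ?case
  proof cases
    case 2
    then show ?thesis using m by (intro bexI[of _ m]) auto
  next
    case 1
    then show ?thesis using m less_trans by (intro bexI[of _ x]) auto
  qed
qed auto

text \<open>Removing the maximum makes \<open>c\<close> exceed everything in \<open>T\<close>, which
  the counting of new products relies on. The proof goes by cardinality because the order dictates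
  which element is removed.\<close>

lemma finite_greatest_induct [consumes 2, case_names empty insert]:
  assumes "finite S" "S \<subseteq> carrier G" and "P {}"
    and step: "\<And>T c. finite T \<Longrightarrow> T \<subseteq> carrier G \<Longrightarrow> c \<in> carrier G \<Longrightarrow> \<forall>t\<in>T. t \<prec>\<^sub>r c
      \<Longrightarrow> P T \<Longrightarrow> P (insert c T)"
  shows "P S"
  using assms(1,2)
proof (induction "card S" arbitrary: S)
  case 0
  then show ?case using \<open>P {}\<close> by simp
next
  case (Suc n)
  then have "S \<noteq> {}" by auto
  then obtain c where c: "c \<in> S" "\<forall>x\<in>S - {c}. x \<prec>\<^sub>r c"
    using finite_has_greatest Suc.prems by blast
  have "P (insert c (S - {c}))"
    using c Suc.prems Suc.hyps(2) by (intro step Suc.hyps(1)) auto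
  then show ?case using c by (simp add: insert_absorb)
qed

section \<open>Generators selected from the top down\<close>

definition irredundant :: "'a set \<Rightarrow> 'a set" where
  "irredundant S = {m \<in> S. m \<notin> generate G {y \<in> S. m \<prec>\<^sub>r y}}"

text \<open>Otherwise take the greatest \<open>m\<close> in \<open>S\<close> outside
  \<open>generate G (irredundant S)\<close>. All elements of \<open>S\<close> above \<open>m\<close>
  lie inside, so they cannot generate \<open>m\<close>; then \<open>m\<close> is irredundant itself,
  a contradiction.\<close>

lemma generate_irredundant:
  assumes "finite S" "S \<subseteq> carrier G"
  shows "generate G (irredundant S) = generate G S"
proof
  have carr: "irredundant S \<subseteq> carrier G" using assms by (auto simp: irredundant_def)
  have "S \<subseteq> generate G (irredundant S)"
  proof (rule ccontr)
    assume "\<not> ?thesis"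
    then obtain m where m: "m \<in> S - generate G (irredundant S)"
      "\<forall>x\<in>S - generate G (irredundant S) - {m}. x \<prec>\<^sub>r m"
      using finite_has_greatest[of "S - generate G (irredundant S)"] assms by auto
    have "{y \<in> S. m \<prec>\<^sub>r y} \<subseteq> generate G (irredundant S)"
      using m(2) less_asym less_irrefl by blast
    then have "generate G {y \<in> S. m \<prec>\<^sub>r y} \<subseteq> generate G (irredundant S)"
      using carr by (intro generate_subgroup_incl generate_is_subgroup)
    then have "m \<in> irredundant S" using m(1) by (auto simp: irredundant_def)
    then show False using m(1) by (auto intro: generate.incl)
  qed
  then show "generate G S \<subseteq> generate G (irredundant S)"
    using carr by (intro generate_subgroup_incl generate_is_subgroup)
qed (intro mono_generate, auto simp: irredundant_def)

text \<open>Taking the larger of the two orders makes an equation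
  \<open>max_prod c m = u \<otimes> v\<close> bound both \<open>c \<otimes> m\<close> and
  \<open>m \<otimes> c\<close>, so that both factors can be compared with \<open>m\<close>.\<close>

definition max_prod :: "'a \<Rightarrow> 'a \<Rightarrow> 'a" where
  "max_prod c m = (if c \<otimes> m \<prec>\<^sub>r m \<otimes> c then m \<otimes> c else c \<otimes> m)"

lemma max_prod_ge:
  assumes "c \<in> carrier G" "m \<in> carrier G"
  shows "c \<otimes> m = max_prod c m \<or> c \<otimes> m \<prec>\<^sub>r max_prod c m"
    and "m \<otimes> c = max_prod c m \<or> m \<otimes> c \<prec>\<^sub>r max_prod c m"
  using assms less_linear[of "c \<otimes> m" "m \<otimes> c"] by (auto simp: max_prod_def)

lemma max_prod_less:
  assumes "c \<in> carrier G" "m \<in> carrier G" "m' \<in> carrier G" "m \<prec>\<^sub>r m'"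
  shows "max_prod c m \<prec>\<^sub>r max_prod c m'"
proof -
  have "c \<otimes> m \<prec>\<^sub>r c \<otimes> m'" "m \<otimes> c \<prec>\<^sub>r m' \<otimes> c"
    using assms by (auto intro: mult_less_left mult_less_right)
  then have "c \<otimes> m \<prec>\<^sub>r max_prod c m'" "m \<otimes> c \<prec>\<^sub>r max_prod c m'"
    using max_prod_ge[of c m'] assms(1,3) by (auto intro: less_trans)
  then show ?thesis by (simp add: max_prod_def[of c m])
qed

lemma inj_on_max_prod:
  assumes "c \<in> carrier G"
  shows "inj_on (max_prod c) (carrier G)"
proof (rule inj_onI)
  fix m m' assume m: "m \<in> carrier G" "m' \<in> carrier G" "max_prod c m = max_prod c m'"
  then show "m = m'"
    using less_linear[of m m'] max_prod_less[OF assms, of m m'] max_prod_less[OF assms, of m' m]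
    by (auto simp: less_irrefl)
qed

section \<open>Adjoining a new maximum\<close>

context
  fixes T :: "'a set" and c :: 'a
  assumes fin: "finite T" and T: "T \<subseteq> carrier G" and c: "c \<in> carrier G"
    and less_c: "\<forall>t\<in>T. t \<prec>\<^sub>r c"
begin

section \<open>Counting the products that appear with \<open>c\<close>\<close>

abbreviation "new_prods \<equiv> (insert c T <#> insert c T) - (T <#> T)"

lemma finite_new_prods: "finite new_prods"
  using fin by (intro finite_Diff finite_set_mult) auto

lemma c_notin: "c \<notin> T"
  using less_c less_irrefl by blast

lemma card_square_insert: "card (insert c T <#> insert c T) = card (T <#> T) + card new_prods"
proof -
  have "T <#> T \<subseteq> insert c T <#> insert c T" by (intro mono_set_mult) auto
  then show ?thesis
    using fin finite_new_prods by (metis Diff_partition card_Un_disjoint Diff_disjoint finite_set_mult)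
qed

text \<open>The cases of \<open>c\<close> and of the maximum of \<open>T\<close> are treated
  together, since either way no element of \<open>T\<close> exceeds \<open>t\<close>. Then
  \<open>u v < c v \<le> c t\<close> and \<open>u v < u c \<le> t c\<close> for all
  \<open>u\<close>, \<open>v\<close> in \<open>T\<close>.\<close>

lemma greatest_prod_new:
  assumes "t = c \<or> t \<in> T \<and> (\<forall>s\<in>T - {t}. s \<prec>\<^sub>r t)"
  shows "c \<otimes> t \<in> new_prods" "t \<otimes> c \<in> new_prods"
proof -
  have le_t: "u = t \<or> u \<prec>\<^sub>r t" if "u \<in> T" for u
    using assms that c T less_c by auto
  have t: "t \<in> carrier G" using assms c T by auto
  have *: "u \<otimes> v \<prec>\<^sub>r c \<otimes> t \<and> u \<otimes> v \<prec>\<^sub>r t \<otimes> c" if uv: "u \<in> T" "v \<in> T" for u v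
  proof -
    have carr: "u \<in> carrier G" "v \<in> carrier G" using uv T by auto
    have "u \<otimes> v \<prec>\<^sub>r c \<otimes> v" "u \<otimes> v \<prec>\<^sub>r u \<otimes> c"
      using uv carr c less_c by (auto intro: mult_less_left mult_less_right)
    moreover have "c \<otimes> v = c \<otimes> t \<or> c \<otimes> v \<prec>\<^sub>r c \<otimes> t" "u \<otimes> c = t \<otimes> c \<or> u \<otimes> c \<prec>\<^sub>r t \<otimes> c"
      using le_t[OF uv(1)] le_t[OF uv(2)] carr c t mult_less_left mult_less_right by blast+
    ultimately show ?thesis by (auto dest: less_trans)
  qed
  have "t \<in> insert c T" using assms by auto
  then show "c \<otimes> t \<in> new_prods" "t \<otimes> c \<in> new_prods"
    using * less_irrefl by (fastforce simp: set_mult_def)+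
qed

lemma max_prod_new:
  assumes m: "m \<in> irredundant (insert c T)"
  shows "max_prod c m \<in> new_prods"
proof
  have m_in: "m \<in> insert c T" and m_gen: "m \<notin> generate G {y \<in> insert c T. m \<prec>\<^sub>r y}"
    using m by (auto simp: irredundant_def)
  have mc: "m \<in> carrier G" using m_in T c by auto
  show "max_prod c m \<in> insert c T <#> insert c T"
    using m_in by (auto simp: max_prod_def intro!: set_multI)
  show "max_prod c m \<notin> T <#> T"
  proof
    assume "max_prod c m \<in> T <#> T"
    then obtain u v where uv: "u \<in> T" "v \<in> T" and eq: "max_prod c m = u \<otimes> v"
      by (auto simp: set_mult_def)
    have carr: "u \<in> carrier G" "v \<in> carrier G" using uv T by auto
    have "u \<otimes> v \<prec>\<^sub>r c \<otimes> v" "u \<otimes> v \<prec>\<^sub>r u \<otimes> c"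
      using uv carr c less_c by (auto intro: mult_less_left mult_less_right)
    \<comment> \<open>Neither \<open>c m\<close> nor \<open>m c\<close> exceeds \<open>u v\<close>,
      so the two bounds just found compare \<open>m\<close> with \<open>v\<close> and with
      \<open>u\<close> once \<open>c\<close> is cancelled.\<close>
    then have "c \<otimes> m \<prec>\<^sub>r c \<otimes> v" "m \<otimes> c \<prec>\<^sub>r u \<otimes> c"
      using max_prod_ge[OF c mc] less_trans unfolding eq by metis+
    then have above: "m \<prec>\<^sub>r v" "m \<prec>\<^sub>r u"
      using carr c mc mult_less_left_cancel mult_less_right_cancel by blast+
    have m_c: "m \<prec>\<^sub>r c" using less_trans[OF above(1)] less_c uv by blast
    let ?H = "generate G {y \<in> insert c T. m \<prec>\<^sub>r y}"
    have sub: "subgroup ?H G" using T c by (intro generate_is_subgroup) auto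
    have in_H: "u \<in> ?H" "v \<in> ?H" "c \<in> ?H"
      using above m_c uv by (auto intro: generate.incl)
    \<comment> \<open>The alternatives are the two possible values of \<open>max_prod c m\<close>;
      each is solved for \<open>m\<close> in terms of \<open>u\<close>, \<open>v\<close> and
      \<open>c\<close>, which all lie above \<open>m\<close>.\<close>
    have "m = inv c \<otimes> (u \<otimes> v) \<or> m = (u \<otimes> v) \<otimes> inv c"
      unfolding eq[symmetric] max_prod_def using c mc by (simp add: m_assoc[symmetric]) (simp add: m_assoc)
    moreover have "inv c \<otimes> (u \<otimes> v) \<in> ?H" "(u \<otimes> v) \<otimes> inv c \<in> ?H"
      by (intro subgroup.m_closed[OF sub] subgroup.m_inv_closed[OF sub] in_H)+
    ultimately show False using m_gen by metis
  qed
qed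

lemma irredundant_carrier: "irredundant (insert c T) \<subseteq> carrier G"
  using T c by (auto simp: irredundant_def)

text \<open>\<open>max_prod c\<close> is injective and sends irredundant elements to new products,
  so the irredundant generators are at most as many.\<close>

lemma generated_by_new_prods: "generated_by_at_most G (generate G (insert c T)) (card new_prods)"
proof (rule generated_by_at_most_card)
  show "generate G (irredundant (insert c T)) = generate G (insert c T)"
    using fin T c by (intro generate_irredundant) auto
  show "irredundant (insert c T) \<subseteq> insert c T" "finite (irredundant (insert c T))"
    using fin by (auto simp: irredundant_def)
  show "card (irredundant (insert c T)) \<le> card new_prods"
    using inj_on_subset[OF inj_on_max_prod[OF c] irredundant_carrier] max_prod_new finite_new_prods
    by (intro card_inj_on_le[of "max_prod c"]) auto
qed

lemma two_le_card_new_prods: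
  assumes "T \<noteq> {}"
  shows "2 \<le> card new_prods"
proof -
  obtain p where p: "p \<in> T" "\<forall>s\<in>T - {p}. s \<prec>\<^sub>r p" using finite_has_greatest[OF fin assms T] by auto
  have "{c \<otimes> c, c \<otimes> p} \<subseteq> new_prods" using greatest_prod_new[of c] greatest_prod_new[of p] p by auto
  moreover have "c \<otimes> c \<noteq> c \<otimes> p" using p T c c_notin by auto
  ultimately show ?thesis using card_mono[OF finite_new_prods, of "{c \<otimes> c, c \<otimes> p}"] by simp
qed

text \<open>With \<open>p\<close> the maximum of \<open>T\<close>, the products \<open>c c\<close>,
  \<open>c p\<close> and \<open>p c\<close> are new and the first differs from the others, so the
  bound forces \<open>c p = p c\<close>. Injectivity of \<open>max_prod c\<close> then leaves only
  \<open>c\<close> and \<open>p\<close> as possible irredundant generators.\<close>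

lemma commuting_if_few_new_prods:
  assumes "card new_prods \<le> 2"
  shows "pairwise_commuting G (insert c T)"
proof (cases "T = {}")
  case True
  then show ?thesis by (simp add: pairwise_commuting_def)
next
  case False
  obtain p where p: "p \<in> T" "\<forall>s\<in>T - {p}. s \<prec>\<^sub>r p" using finite_has_greatest[OF fin False T] by auto
  have pc: "p \<in> carrier G" "p \<noteq> c" using p T c_notin by auto
  have sub: "{c \<otimes> c, c \<otimes> p, p \<otimes> c} \<subseteq> new_prods"
    using greatest_prod_new[of c] greatest_prod_new[of p] p by auto
  have neq: "c \<otimes> c \<noteq> c \<otimes> p" "c \<otimes> c \<noteq> p \<otimes> c" using pc c by auto
  have comm: "c \<otimes> p = p \<otimes> c"
  proof (rule ccontr)
    assume "c \<otimes> p \<noteq> p \<otimes> c"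
    then show False using card_mono[OF finite_new_prods sub] neq assms by simp
  qed
  have new: "new_prods = {c \<otimes> c, c \<otimes> p}"
    using sub neq assms by (intro card_seteq[symmetric] finite_new_prods) auto
  have "irredundant (insert c T) \<subseteq> {c, p}"
  proof
    fix m assume m: "m \<in> irredundant (insert c T)"
    then have mc: "m \<in> carrier G" using irredundant_carrier by blast
    \<comment> \<open>Since \<open>c\<close> commutes with itself and with \<open>p\<close>, both
      new products are values of \<open>max_prod c\<close>.\<close>
    have "max_prod c m \<in> {max_prod c c, max_prod c p}"
      using max_prod_new[OF m] comm less_irrefl unfolding new by (auto simp: max_prod_def)
    then show "m \<in> {c, p}" using inj_on_max_prod[OF c] mc c pc by (auto dest: inj_onD)
  qed
  moreover have "pairwise_commuting G {c, p}" using comm by (auto simp: pairwise_commuting_def)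
  ultimately have "pairwise_commuting G (irredundant (insert c T))"
    by (rule commuting_subset[rotated])
  then have "pairwise_commuting G (generate G (irredundant (insert c T)))"
    by (intro commuting_generate irredundant_carrier)
  then have "pairwise_commuting G (generate G (insert c T))"
    using generate_irredundant[of "insert c T"] fin T c by simp
  then show ?thesis by (rule commuting_subset) (auto intro: generate.incl)
qed

text \<open>Take the least \<open>t\<close> not commuting with \<open>c\<close> and write
  \<open>c t = u c\<close>, \<open>t c = c v\<close>. Then \<open>u\<close> and \<open>v\<close>
  fail to commute with \<open>c\<close> and differ from \<open>t\<close>, so they lie above it. This
  gives \<open>t c < u c = c t\<close> and \<open>c t < c v = t c\<close>.\<close>

lemma centralizes_if_normalizes:
  assumes "(\<lambda>t. c \<otimes> t) ` T = (\<lambda>t. t \<otimes> c) ` T" and "t \<in> T"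
  shows "c \<otimes> t = t \<otimes> c"
proof (rule ccontr)
  let ?B = "{t \<in> T. c \<otimes> t \<noteq> t \<otimes> c}"
  assume "c \<otimes> t \<noteq> t \<otimes> c"
  then have "?B \<noteq> {}" using assms(2) by auto
  then obtain t where t: "t \<in> T" "c \<otimes> t \<noteq> t \<otimes> c" and least: "\<forall>s\<in>?B - {t}. t \<prec>\<^sub>r s"
    using finite_has_least[of ?B] fin T by auto
  obtain u where u: "u \<in> T" "c \<otimes> t = u \<otimes> c" using assms(1) t(1) by (auto simp: image_iff set_eq_iff)
  obtain v where v: "v \<in> T" "t \<otimes> c = c \<otimes> v"
    using assms(1) t(1) by (metis (no_types, lifting) image_iff)
  have carr: "t \<in> carrier G" "u \<in> carrier G" "v \<in> carrier G" using t u v T by auto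
  \<comment> \<open>If \<open>u\<close> commuted with \<open>c\<close>, then
    \<open>c t = u c = c u\<close> would give \<open>t = u\<close>, and \<open>t\<close> would
    commute with \<open>c\<close>. The argument for \<open>v\<close> is symmetric.\<close>
  have "c \<otimes> u \<noteq> u \<otimes> c" using t(2) u(2) carr c l_cancel[of c u t] by metis
  moreover have "c \<otimes> v \<noteq> v \<otimes> c" using t(2) v(2) carr c r_cancel[of v c t] by metis
  ultimately have "u \<in> ?B - {t}" "v \<in> ?B - {t}" using t u v by auto
  then have "t \<otimes> c \<prec>\<^sub>r u \<otimes> c" "c \<otimes> t \<prec>\<^sub>r c \<otimes> v"
    using least carr c by (auto intro: mult_less_left mult_less_right)
  then show False using u(2) v(2) less_asym by metis
qed

text \<open>\<open>T T\<close> lies in \<open>generate G T\<close>, while \<open>c T\<close> and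
  \<open>T c\<close> avoid it and have \<open>card T\<close> elements each. If \<open>c\<close> does
  not centralize \<open>T\<close>, these two sets differ by
  \<open>centralizes_if_normalizes\<close>; being of equal size, they have a strictly larger
  union.\<close>

lemma card_new_prods_if_not_generated:
  assumes "c \<notin> generate G T"
  shows "Suc (card T) \<le> card new_prods"
    and "\<not> (\<forall>t\<in>T. c \<otimes> t = t \<otimes> c) \<Longrightarrow> Suc (Suc (card T)) \<le> card new_prods"
proof -
  let ?L = "(\<lambda>t. c \<otimes> t) ` T" and ?R = "(\<lambda>t. t \<otimes> c) ` T"
  have sub: "subgroup (generate G T) G" using T by (rule generate_is_subgroup)
  have TT: "T <#> T \<subseteq> generate G T"
    by (auto simp: set_mult_def intro!: subgroup.m_closed[OF sub] intro: generate.incl)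
  have "c \<otimes> t \<notin> generate G T" "t \<otimes> c \<notin> generate G T" if "t \<in> T" for t
  proof -
    have t: "t \<in> generate G T" "t \<in> carrier G" using that T by (auto intro: generate.incl)
    have inv: "inv t \<in> generate G T" using t(1) by (rule subgroup.m_inv_closed[OF sub])
    show "c \<otimes> t \<notin> generate G T"
      using subgroup.m_closed[OF sub _ inv, of "c \<otimes> t"] assms t c by (auto simp: m_assoc)
    show "t \<otimes> c \<notin> generate G T"
      using subgroup.m_closed[OF sub inv, of "t \<otimes> c"] assms t c by (auto simp: m_assoc[symmetric])
  qed
  then have LR: "?L \<union> ?R \<subseteq> new_prods" using TT by (auto intro: set_multI)
  \<comment> \<open>\<open>c c\<close> may lie in \<open>generate G T\<close> although
    \<open>c\<close> does not, so that it is new comes from the order.\<close>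
  have cc: "c \<otimes> c \<in> new_prods" using greatest_prod_new[of c] by simp
  have cc_notin: "c \<otimes> c \<notin> ?L \<union> ?R" using c T c_notin by (auto simp: subset_iff)
  have cardL: "card ?L = card T" using T c by (intro card_image inj_onI) (auto simp: subset_iff)
  have cardR: "card ?R = card T" using T c by (intro card_image inj_onI) (auto simp: subset_iff)
  have "Suc (card (?L \<union> ?R)) = card (insert (c \<otimes> c) (?L \<union> ?R))"
    using fin cc_notin by simp
  also have "\<dots> \<le> card new_prods" using LR cc by (intro card_mono finite_new_prods) auto
  finally have le: "Suc (card (?L \<union> ?R)) \<le> card new_prods" .
  have "card T \<le> card (?L \<union> ?R)" using cardL card_mono[of "?L \<union> ?R" ?L] fin by simp
  then show "Suc (card T) \<le> card new_prods" using le by simp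
  assume "\<not> (\<forall>t\<in>T. c \<otimes> t = t \<otimes> c)"
  then have "?L \<noteq> ?R" using centralizes_if_normalizes by blast
  then have "\<not> ?R \<subseteq> ?L" using card_subset_eq[of ?L ?R] fin cardL cardR by auto
  then have "?L \<subset> ?L \<union> ?R" by blast
  then have "card T < card (?L \<union> ?R)" using psubset_card_mono[of "?L \<union> ?R" ?L] fin cardL by simp
  then show "Suc (Suc (card T)) \<le> card new_prods" using le by simp
qed

section \<open>Preserving commutativity when \<open>c\<close> is added\<close>

lemma commuting_insert_if_generated:
  assumes "c \<in> generate G T" "pairwise_commuting G T"
  shows "pairwise_commuting G (insert c T)"
  using assms(1) by (intro commuting_subset[OF commuting_generate[OF T assms(2)]])
    (auto intro: generate.incl)

lemma commuting_insert_if_centralizes: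
  assumes "\<forall>t\<in>T. c \<otimes> t = t \<otimes> c" "pairwise_commuting G T"
  shows "pairwise_commuting G (insert c T)"
  using assms by (auto simp: pairwise_commuting_def)

end

section \<open>Small doubling\<close>

text \<open>Each new maximum adds at least two products, except that the first adds only
  \<open>c c\<close>; this accounts for the \<open>+ 1\<close>.\<close>

lemma card_square_ge:
  assumes "finite S" "S \<subseteq> carrier G"
  shows "2 * card S \<le> card (S <#> S) + 1"
  using assms
proof (induction S rule: finite_greatest_induct)
  case (insert T c)
  note hyps = insert.hyps
  show ?case
  proof (cases "T = {}")
    case True
    then show ?thesis by (simp add: set_mult_def)
  next
    case False
    then show ?thesis
      using insert.IH two_le_card_new_prods[OF hyps] card_square_insert[OF hyps]
        c_notin[OF hyps] hyps(1) by simp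
  qed
qed simp

text \<open>Two or fewer new products settle the claim at once. Otherwise at least three are new, so
  \<open>T\<close> inherits the hypothesis; moreover \<open>c\<close> must lie in
  \<open>generate G T\<close>, and adding it changes neither commutativity nor the subgroup.\<close>

lemma small_doubling_3k_minus_4:
  assumes "finite S" "S \<subseteq> carrier G" and "card (S <#> S) + 4 \<le> 3 * card S"
  shows "pairwise_commuting G S \<and> generated_by_at_most G (generate G S) 2"
  using assms
proof (induction S rule: finite_greatest_induct)
  case empty
  then show ?case by simp
next
  case (insert T c)
  note hyps = insert.hyps
  note sq = card_square_insert[OF hyps]
  have card: "card (insert c T) = Suc (card T)" using hyps(1) c_notin[OF hyps] by simp
  show ?case
  proof (cases "card (new_prods T c) \<le> 2")
    case True
    then show ?thesis
      using commuting_if_few_new_prods[OF hyps True]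
        generated_by_at_most_mono[OF generated_by_new_prods[OF hyps] True] by simp
  next
    case False
    then have IH: "pairwise_commuting G T" "generated_by_at_most G (generate G T) 2"
      using insert.IH insert.prems sq card by auto
    \<comment> \<open>Outside, \<open>c\<close> would bring at least \<open>card T + 1\<close> new
      products on top of at least \<open>2 card T - 1\<close> old ones. The sum
      \<open>3 card T\<close> is one more than the hypothesis allows.\<close>
    have gen: "c \<in> generate G T"
      using card_new_prods_if_not_generated(1)[OF hyps] card_square_ge[OF hyps(1,2)]
        insert.prems sq card by force
    then show ?thesis
      using IH commuting_insert_if_generated[OF hyps] generate_insert_absorb[OF hyps(2)] by simp
  qed
qed

lemma generated_by_at_most_card_self:
  "finite S \<Longrightarrow> card S \<le> n \<Longrightarrow> generated_by_at_most G (generate G S) n"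
  by (rule generated_by_at_most_card) auto

text \<open>With three or more new products, \<open>T\<close> satisfies this hypothesis or that of
  \<open>small_doubling_3k_minus_4\<close>, hence commutes. If \<open>c\<close> lies outside
  \<open>generate G T\<close>, the count is so tight that \<open>c\<close> centralizes
  \<open>T\<close> and \<open>T\<close> needs only two generators, leaving the third for
  \<open>c\<close>.\<close>

lemma small_doubling_3k_minus_3:
  assumes "finite S" "S \<subseteq> carrier G" and "card (S <#> S) + 3 = 3 * card S"
  shows "pairwise_commuting G S \<and> generated_by_at_most G (generate G S) 3"
  using assms
proof (induction S rule: finite_greatest_induct)
  case empty
  then show ?case by simp
next
  case (insert T c)
  note hyps = insert.hyps
  note sq = card_square_insert[OF hyps]
  let ?N = "new_prods T c"
  have card: "card (insert c T) = Suc (card T)" using hyps(1) c_notin[OF hyps] by simp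
  show ?case
  proof (cases "card ?N \<le> 2")
    case True
    then show ?thesis
      using commuting_if_few_new_prods[OF hyps True]
        generated_by_at_most_mono[OF generated_by_new_prods[OF hyps], of 3] by simp
  next
    case False
    then have "card (T <#> T) + 4 \<le> 3 * card T \<or> card (T <#> T) + 3 = 3 * card T"
      using insert.prems sq card by linarith
    then have IH: "pairwise_commuting G T" "generated_by_at_most G (generate G T) 3"
      using insert.IH small_doubling_3k_minus_4[OF hyps(1,2)]
        generated_by_at_most_mono[of _ 2 3] by auto
    show ?thesis
    proof (cases "c \<in> generate G T")
      case True
      then show ?thesis
        using IH commuting_insert_if_generated[OF hyps] generate_insert_absorb[OF hyps(2)] by simp
    next
      case outside: False
      \<comment> \<open>The total is \<open>3 card T\<close> and \<open>T T\<close> has at least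
        \<open>2 card T - 1\<close> elements, so exactly \<open>card T + 1\<close> products are
        new.\<close>
      have N: "Suc (card T) \<le> card ?N" "\<not> Suc (Suc (card T)) \<le> card ?N"
        using card_new_prods_if_not_generated(1)[OF hyps outside] card_square_ge[OF hyps(1,2)]
          insert.prems sq card by auto
      then have "\<forall>t\<in>T. c \<otimes> t = t \<otimes> c"
        using card_new_prods_if_not_generated(2)[OF hyps outside] by blast
      then have comm: "pairwise_commuting G (insert c T)"
        using IH commuting_insert_if_centralizes[OF hyps] by blast
      \<comment> \<open>Exactly \<open>2 card T - 1\<close> products are old, and this is at most
        \<open>3 card T - 4\<close> once \<open>card T \<ge> 3\<close>. A smaller \<open>T\<close>
        has at most two elements anyway.\<close>
      have "generated_by_at_most G (generate G T) 2"
      proof (cases "card T \<le> 2")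
        case True
        then show ?thesis using hyps(1) by (intro generated_by_at_most_card_self)
      next
        case False
        then show ?thesis
          using small_doubling_3k_minus_4[OF hyps(1,2)] insert.prems sq card N by simp
      qed
      then show ?thesis
        using comm generated_by_at_most_insert[OF hyps(2,3)] by (simp add: numeral_3_eq_3 numeral_2_eq_2)
    qed
  qed
qed

text \<open>More than \<open>b + 2\<close> new products leave \<open>T\<close> commuting with at
  most three generators. A \<open>c\<close> outside \<open>generate G T\<close> costs one more, and
  four exceeds \<open>b + 2\<close> only for \<open>b = 1\<close>; this is where the exceptional
  sets of four elements arise.\<close>

lemma small_doubling_3k_minus_3_plus:
  assumes "finite S" "S \<subseteq> carrier G" and "1 \<le> b" and "card (S <#> S) + 3 = 3 * card S + b"
  shows "card S = 4 \<and> b = 1 \<and> pairwise_commuting G S \<or> generated_by_at_most G (generate G S) (b + 2)"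
  using assms
proof (induction S arbitrary: b rule: finite_greatest_induct)
  case empty
  then show ?case by (simp add: generated_by_at_most_card_self)
next
  case (insert T c)
  note hyps = insert.hyps
  note sq = card_square_insert[OF hyps]
  let ?N = "new_prods T c"
  have card: "card (insert c T) = Suc (card T)" using hyps(1) c_notin[OF hyps] by simp
  note mono = generated_by_at_most_mono
  show ?case
  proof (cases "card ?N \<le> b + 2")
    case True
    then show ?thesis using mono[OF generated_by_new_prods[OF hyps] True] by simp
  next
    \<comment> \<open>\<open>|T\<^sup>2| = 3|T| - 3 + (b + 3 - |?N|)\<close>, so \<open>T\<close> falls under the cases without excess\<close>
    case False
    then have T_small: "card (T <#> T) + 4 \<le> 3 * card T \<or> card (T <#> T) + 3 = 3 * card T"
      using insert.prems sq card by linarith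
    then have T3: "pairwise_commuting G T" "generated_by_at_most G (generate G T) 3"
      using small_doubling_3k_minus_4[OF hyps(1,2)] small_doubling_3k_minus_3[OF hyps(1,2)]
        mono[of _ 2 3] by auto
    show ?thesis
    proof (cases "c \<in> generate G T")
      case True
      then show ?thesis
        using T3 generate_insert_absorb[OF hyps(2) True] mono[of _ 3 "b + 2"] insert.prems by simp
    next
      case outside: False
      note ins = generated_by_at_most_insert[OF hyps(2,3)]
      \<comment> \<open>For \<open>b = 1\<close> the target is three generators: \<open>T\<close>
        needs only two, or \<open>S\<close> has at most three elements, or \<open>T\<close> sits at
        the boundary \<open>3 card T - 3\<close>.\<close>
      consider "2 \<le> b" | "b = 1" "card (T <#> T) + 4 \<le> 3 * card T"
        | "b = 1" "card T \<le> 2" | "b = 1" "card T \<ge> 3" "card (T <#> T) + 3 = 3 * card T"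
        using T_small insert.prems by linarith
      then show ?thesis
      proof cases
        case 1
        then show ?thesis using ins[OF T3(2)] mono[of _ 4 "b + 2"] by simp
      next
        case 2
        then show ?thesis
          using ins[of 2] small_doubling_3k_minus_4[OF hyps(1,2)] by (simp add: eval_nat_numeral)
      next
        case 3
        then show ?thesis using card hyps(1) by (intro disjI2 generated_by_at_most_card_self) auto
      next
        case 4
        \<comment> \<open>The total is \<open>3 card T + 1\<close>, so four products are new. A
          maximum outside \<open>generate G T\<close> brings at least \<open>card T + 1\<close>,
          hence \<open>card T = 3\<close>; without centralizing \<open>T\<close> it would bring at
          least five.\<close>
        then have "card ?N = 4" using insert.prems sq card by linarith
        then have "card T = 3" "\<not> Suc (Suc (card T)) \<le> card ?N"
          using 4 card_new_prods_if_not_generated(1)[OF hyps outside] by auto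
        then show ?thesis
          using 4 card T3(1) card_new_prods_if_not_generated(2)[OF hyps outside]
            commuting_insert_if_centralizes[OF hyps] by auto
      qed
    qed
  qed
qed

end

theorem theorem2p5:
  fixes G (structure) and r :: "'a rel" and S :: "'a set"
  assumes "ordered_group G r"
    and "finite S" and "S \<subseteq> carrier G"
  shows "int (card (S <#> S)) \<ge> 2 * int (card S) - 1
    \<and> (2 * int (card S) - 1 \<le> int (card (S <#> S))
        \<and> int (card (S <#> S)) \<le> 3 * int (card S) - 4 \<longrightarrow>
          comm_group (G\<lparr>carrier := generate G S\<rparr>)
          \<and> generated_by_at_most G (generate G S) 2)
    \<and> (int (card (S <#> S)) = 3 * int (card S) - 3 \<longrightarrow>
          comm_group (G\<lparr>carrier := generate G S\<rparr>)
          \<and> generated_by_at_most G (generate G S) 3)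
    \<and> (\<forall>b::nat. b \<ge> 1 \<and> int (card (S <#> S)) = 3 * int (card S) - 3 + int b \<longrightarrow>
          (card S = 4 \<and> b = 1
            \<and> comm_group (G\<lparr>carrier := generate G S\<rparr>)
            \<and> generated_by_at_most G (generate G S) (b + 3))
          \<or> generated_by_at_most G (generate G S) (b + 2))"
proof -
  interpret ordered_group G r by fact
  note S = assms(2,3)
  note comm = comm_group_generate[OF S(2)]
  show ?thesis
  proof (intro conjI allI impI; (elim conjE)?)
    show "int (card (S <#> S)) \<ge> 2 * int (card S) - 1"
      using card_square_ge[OF S] by linarith
  next
    assume "int (card (S <#> S)) \<le> 3 * int (card S) - 4"
    then have "card (S <#> S) + 4 \<le> 3 * card S" by linarith
    then show "comm_group (G\<lparr>carrier := generate G S\<rparr>)"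
      "generated_by_at_most G (generate G S) 2"
      using small_doubling_3k_minus_4[OF S] comm by auto
  next
    assume "int (card (S <#> S)) = 3 * int (card S) - 3"
    then have "card (S <#> S) + 3 = 3 * card S" by linarith
    then show "comm_group (G\<lparr>carrier := generate G S\<rparr>)"
      "generated_by_at_most G (generate G S) 3"
      using small_doubling_3k_minus_3[OF S] comm by auto
  next
    fix b :: nat
    assume b: "b \<ge> 1" and "int (card (S <#> S)) = 3 * int (card S) - 3 + int b"
    then have "card (S <#> S) + 3 = 3 * card S + b" by linarith
    then consider "card S = 4" "b = 1" "pairwise_commuting G S" | "generated_by_at_most G (generate G S) (b + 2)"
      using small_doubling_3k_minus_3_plus[OF S b] by blast
    \<comment> \<open>In the exceptional case \<open>b + 3 = 4 = card S\<close>, so \<open>S\<close>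
      is its own set of generators.\<close>
    then show "(card S = 4 \<and> b = 1
            \<and> comm_group (G\<lparr>carrier := generate G S\<rparr>)
            \<and> generated_by_at_most G (generate G S) (b + 3))
          \<or> generated_by_at_most G (generate G S) (b + 2)"
      using comm generated_by_at_most_card_self[OF S(1), of 4] by cases simp_all
  qed
qed

end
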